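(* Let $A, S, \bar S$ be finite sets with $\sharp S=\sharp \bar S$, and let $f:A\to A$, $h:S\to\bar S$, $\lambda:A\to S$, $\bar\lambda:A\to\bar S$ be maps such that $\bar\lambda\circ f=h\circ\lambda$ and both $\lambda$ and $\bar\lambda$ are surjective. Suppose $f$ is a bijection (so that $h$ is also a bijection), and let $f^{-1}:A\to A$ and $h^{-1}:\bar S\to S$ be the compositional inverses of $f$ and $h$. Then $\lambda\circ f^{-1}=h^{-1}\circ\bar\lambda$.
   Context: $\sharp X$ denotes the cardinality of a finite set $X$. By the AGW criterion, in the stated setting $f$ is a bijection if and only if $h$ is a bijection and $f$ is injective on $\lambda^{-1}(s)$ for each $s\in S$; in particular $h^{-1}$ exists when $f$ is a bijection. *)

theory Defs
  imports "HOL-Library.FuncSet"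
begin

end

theory Submission imports Defs begin

text \<open>Along the commuting square, surjectivity of \<open>lam\<close>, \<open>f\<close> and
  \<open>lambar\<close> makes \<open>h\<close> surjective: \<open>h\<close> maps
  \<open>S = lam(A)\<close> onto \<open>lambar(f(A)) = Sbar\<close>. As \<open>S\<close> and
  \<open>Sbar\<close> are finite of equal size, \<open>h\<close> is bijective. Reading the square at
  the preimage of \<open>x\<close> under \<open>f\<close> and cancelling \<open>h\<close> gives the
  identity of inverses.\<close>

theorem theorem2p1:
  fixes A :: "'a set" and S :: "'b set" and Sbar :: "'c set"
    and f :: "'a \<Rightarrow> 'a" and h :: "'b \<Rightarrow> 'c"
    and lam :: "'a \<Rightarrow> 'b" and lambar :: "'a \<Rightarrow> 'c"
  assumes "finite A" and "finite S" and "finite Sbar"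
    and "card S = card Sbar"
    and "f \<in> A \<rightarrow> A" and "h \<in> S \<rightarrow> Sbar"
    and "lam \<in> A \<rightarrow> S" and "lambar \<in> A \<rightarrow> Sbar"
    and "\<forall>x\<in>A. (lambar \<circ> f) x = (h \<circ> lam) x"
    and "lam ` A = S" and "lambar ` A = Sbar"
    and "bij_betw f A A"
  shows "bij_betw h S Sbar \<and>
    (\<forall>x\<in>A. (lam \<circ> inv_into A f) x = (inv_into S h \<circ> lambar) x)"
proof -
  have fA: "f ` A = A"
    using assms(12) by (rule bij_betw_imp_surj_on)
  have comm: "lambar (f x) = h (lam x)" if "x \<in> A" for x
    using assms(9) that by simp
  have "h ` S = (\<lambda>x. h (lam x)) ` A"
    using assms(10) by blast
  also have "\<dots> = (\<lambda>x. lambar (f x)) ` A"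
    using comm by simp
  also have "\<dots> = lambar ` (f ` A)"
    by (simp add: image_image)
  also have "\<dots> = Sbar"
    using fA assms(11) by simp
  finally have surj: "h ` S = Sbar" .
  \<comment> \<open>The image of the finite set \<open>S\<close> has as many elements as
    \<open>S\<close>, so no two elements collide.\<close>
  then have inj: "inj_on h S"
    using assms(2,4) by (simp add: eq_card_imp_inj_on)
  have "lam (inv_into A f x) = inv_into S h (lambar x)" if "x \<in> A" for x
  proof -
    let ?y = "inv_into A f x"
    have y: "?y \<in> A" "f ?y = x"
      using that fA by (auto intro: inv_into_into f_inv_into_f)
    then have "lam ?y \<in> S" "h (lam ?y) = lambar x"
      using comm[of ?y] assms(7) by auto
    \<comment> \<open>\<open>inv_into S h\<close> merely picks some preimage in \<open>S\<close>;
      injectivity of \<open>h\<close> forces the pick at \<open>lambar x\<close> to be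
      \<open>lam ?y\<close>.\<close>
    then show ?thesis
      using inv_into_f_f[OF inj] by metis
  qed
  with inj surj show ?thesis
    by (simp add: bij_betw_def)
qed

end
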